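(* Consider the system $x(k+1)=A_{k+1}x(k)$, $x(0)=x_0$, $y(k)=H_kx(k)+v_k$ ($k\ge 0$) and, for a sequence of gain matrices $K_k\in\mathbb{C}^{d\times m}$, $k\ge 1$, the estimators $\widehat{x}_k=\widehat{x}_{k-1}+K_k\big(y(k-1)-\widetilde{H}_{k-1}\widehat{x}_{k-1}\big)$ of $x_0$, started from an initial guess $\widehat{x}_0$. Let $P_k$ denote the covariance matrix of the error $e_k=\widehat{x}_k-x_0$, where $P_0$ is the initial guess for the error covariance. If at each step $k\ge 1$ the matrix $K_k$ is chosen so as to minimize $J=\tfrac12\mathrm{Tr}(P_k)$, then the solution of this minimization problem is $$K_k=P_{k-1}\widetilde{H}_{k-1}^*\left(\widetilde{H}_{k-1}P_{k-1}\widetilde{H}_{k-1}^*+R_{k-1}\right)^{-1},$$ and the update of the error covariance matrix is given by $$P_k=P_{k-1}-K_k\widetilde{H}_{k-1}P_{k-1}.$$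
   Context: Let $m<d$ be positive integers. For each $k$, $A_k\in\mathbb{C}^{d\times d}$ is invertible and $H_k\in\mathbb{C}^{m\times d}$. The state $x_0\in\mathbb{C}^d$ is unknown but deterministic. The noise $\{v_k\}_{k\ge0}$ is a random process with $v_k\sim N(0,R_k)$ (mean zero) and $\mathbb{E}(v_jv_k^* )=R_k\delta_{j,k}$, where the $R_k$ are $m\times m$ real symmetric positive definite matrices and there is a fixed $\sigma^2>0$ with $R_k\ge\sigma^2\mathbb{I}$ for all $k\ge0$ (Loewner order; $\mathbb{I}$ is the identity matrix). Set $A(0,0)=\mathbb{I}$, $A(k,0)=A_kA_{k-1}\cdots A_1$ for $k\ge1$, and $\widetilde{H}_k=H_kA(k,0)$, so that $y(k)=\widetilde{H}_kx_0+v_k$. The error covariance is $$P_k=\mathrm{Cov}(e_k,e_k)=\mathbb{E}(e_ke_k^* )-\mathbb{E}(e_k)\mathbb{E}(e_k)^*,$$ with $P_0$ (Hermitian positive semidefinite) the covariance of $e_0=\widehat{x}_0-x_0$. The initial guess $\widehat{x}_0$ is uncorrelated with the noise, i.e. $\mathbb{E}(v_ke_0^* )=0$ for all $k\ge0$. The minimization at step $k$ is over $K_k\in\mathbb{C}^{d\times m}$, with the gains $K_1,\dots,K_{k-1}$ from the previous steps (hence $P_{k-1}$) fixed. The superscript $^*$ denotes conjugate transpose. *)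

theory Defs
  imports "HOL-Probability.Probability"
begin

definition conj_transpose :: "complex^'n^'m \<Rightarrow> complex^'m^'n" where
  "conj_transpose A = (\<chi> i j. cnj (A $ j $ i))"

definition cvec :: "real^'n \<Rightarrow> complex^'n" where
  "cvec x = (\<chi> i. complex_of_real (x $ i))"

definition cmat :: "real^'n^'m \<Rightarrow> complex^'n^'m" where
  "cmat A = map_matrix complex_of_real A"

text \<open>\<open>outer u w\<close> is the rank-one matrix \<open>u w\<^sup>*\<close>, with the conjugate on the second factor.\<close>

definition outer :: "complex^'m \<Rightarrow> complex^'n \<Rightarrow> complex^'n^'m" where
  "outer u w = (\<chi> i j. u $ i * cnj (w $ j))"

definition pos_semidef :: "real^'n^'n \<Rightarrow> bool" where
  "pos_semidef A \<longleftrightarrow> transpose A = A \<and> (\<forall>x. 0 \<le> x \<bullet> (A *v x))"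

definition pos_def :: "real^'n^'n \<Rightarrow> bool" where
  "pos_def A \<longleftrightarrow> transpose A = A \<and> (\<forall>x. x \<noteq> 0 \<longrightarrow> 0 < x \<bullet> (A *v x))"

definition loewner_le :: "real^'n^'n \<Rightarrow> real^'n^'n \<Rightarrow> bool" where
  "loewner_le A B \<longleftrightarrow> pos_semidef (B - A)"

text \<open>Density of the centred Gaussian law \<open>N(0, R)\<close> with positive definite covariance \<open>R\<close>.\<close>

definition mvn_density :: "real^'n^'n \<Rightarrow> real^'n \<Rightarrow> real" where
  "mvn_density R x =
     exp (- (x \<bullet> (matrix_inv R *v x)) / 2) / sqrt ((2 * pi) ^ CARD('n) * det R)"

text \<open>Expectations of vectors and matrices are Bochner integrals, i.e. entrywise expectations.\<close>

definition cov :: "'w measure \<Rightarrow> ('w \<Rightarrow> complex^'m) \<Rightarrow> ('w \<Rightarrow> complex^'n) \<Rightarrow> complex^'n^'m" where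
  "cov M X Y = (LINT \<omega>|M. outer (X \<omega>) (Y \<omega>)) - outer (LINT \<omega>|M. X \<omega>) (LINT \<omega>|M. Y \<omega>)"

fun transition :: "(nat \<Rightarrow> complex^'d^'d) \<Rightarrow> nat \<Rightarrow> complex^'d^'d" where
  "transition A 0 = mat 1"
| "transition A (Suc k) = A (Suc k) ** transition A k"

definition obs_tilde ::
  "(nat \<Rightarrow> complex^'d^'d) \<Rightarrow> (nat \<Rightarrow> complex^'d^'m) \<Rightarrow> nat \<Rightarrow> complex^'d^'m" where
  "obs_tilde A H k = H k ** transition A k"

fun state :: "(nat \<Rightarrow> complex^'d^'d) \<Rightarrow> complex^'d \<Rightarrow> nat \<Rightarrow> complex^'d" where
  "state A x0 0 = x0"
| "state A x0 (Suc k) = A (Suc k) *v state A x0 k"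

definition measurement ::
  "(nat \<Rightarrow> complex^'d^'d) \<Rightarrow> (nat \<Rightarrow> complex^'d^'m) \<Rightarrow> complex^'d \<Rightarrow>
   (nat \<Rightarrow> 'w \<Rightarrow> real^'m) \<Rightarrow> nat \<Rightarrow> 'w \<Rightarrow> complex^'m" where
  "measurement A H x0 v k \<omega> = H k *v state A x0 k + cvec (v k \<omega>)"

fun estimator ::
  "(nat \<Rightarrow> complex^'d^'d) \<Rightarrow> (nat \<Rightarrow> complex^'d^'m) \<Rightarrow> complex^'d \<Rightarrow>
   (nat \<Rightarrow> 'w \<Rightarrow> real^'m) \<Rightarrow> ('w \<Rightarrow> complex^'d) \<Rightarrow> (nat \<Rightarrow> complex^'m^'d) \<Rightarrow>
   nat \<Rightarrow> 'w \<Rightarrow> complex^'d" where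
  "estimator A H x0 v xh0 K 0 \<omega> = xh0 \<omega>"
| "estimator A H x0 v xh0 K (Suc k) \<omega> =
     estimator A H x0 v xh0 K k \<omega>
       + K (Suc k) *v (measurement A H x0 v k \<omega> - obs_tilde A H k *v estimator A H x0 v xh0 K k \<omega>)"

definition error_cov ::
  "'w measure \<Rightarrow> (nat \<Rightarrow> complex^'d^'d) \<Rightarrow> (nat \<Rightarrow> complex^'d^'m) \<Rightarrow> complex^'d \<Rightarrow>
   (nat \<Rightarrow> 'w \<Rightarrow> real^'m) \<Rightarrow> ('w \<Rightarrow> complex^'d) \<Rightarrow> (nat \<Rightarrow> complex^'m^'d) \<Rightarrow>
   nat \<Rightarrow> complex^'d^'d" where
  "error_cov M A H x0 v xh0 K k =
     (let e = (\<lambda>\<omega>. estimator A H x0 v xh0 K k \<omega> - x0) in cov M e e)"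

text \<open>
  The real part only converts the type: the trace of a covariance matrix \<open>cov M X X\<close> is real
  (lemma \<open>trace_cov_real\<close>).
\<close>

definition cost :: "complex^'d^'d \<Rightarrow> real" where
  "cost P = Re (trace P) / 2"

lemma conj_transpose_cov: "conj_transpose (cov M X X) = cov M X X"
proof -
  have bct: "bounded_linear (conj_transpose :: complex^'a^'a \<Rightarrow> _)"
    by (intro linear_conv_bounded_linear[THEN iffD1] linearI)
       (simp_all add: conj_transpose_def vec_eq_iff)
  have sw: "conj_transpose (outer u w) = outer w u" for u w :: "complex^'a"
    by (simp add: conj_transpose_def outer_def vec_eq_iff)
  have "conj_transpose (LINT \<omega>|M. outer (X \<omega>) (X \<omega>)) = (LINT \<omega>|M. outer (X \<omega>) (X \<omega>))"
  proof (cases "integrable M (\<lambda>\<omega>. outer (X \<omega>) (X \<omega>))")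
    case True
    from integral_bounded_linear[OF bct True] show ?thesis by (simp add: sw)
  next
    case False
    then show ?thesis
      by (simp add: not_integrable_integral_eq conj_transpose_def vec_eq_iff)
  qed
  then show ?thesis
    unfolding cov_def linear_diff[OF bounded_linear.linear[OF bct]] by (simp add: sw)
qed

lemma trace_cov_real: "trace (cov M X X) \<in> \<real>"
proof -
  have "cnj (trace (cov M X X)) = trace (conj_transpose (cov M X X))"
    by (simp add: trace_def conj_transpose_def)
  then show ?thesis by (simp add: conj_transpose_cov Reals_cnj_iff)
qed

end

theory Submission
  imports Defs
begin

text \<open>
  The error obeys \<open>e\<^sub>k = (I - K\<^sub>k H) e\<^sub>k\<^sub>-\<^sub>1 + K\<^sub>k v\<^sub>k\<^sub>-\<^sub>1\<close>, where \<open>H\<close> is the transported observation matrix, and by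
  induction \<open>e\<^sub>k\<^sub>-\<^sub>1\<close> is uncorrelated with all noise from time \<open>k - 1\<close> on. Hence \<open>P\<^sub>k\<close> is a quadratic
  polynomial in the gain, and completing the square with \<open>S = H P H\<^sup>* + R\<close> and \<open>G = P H\<^sup>* S\<^sup>-\<^sup>1\<close> gives
  \<open>P\<^sub>k = (P - G H P) + (K\<^sub>k - G) S (K\<^sub>k - G)\<^sup>*\<close>. Since \<open>S\<close> is positive definite, the trace of the last term
  is positive unless \<open>K\<^sub>k = G\<close>.
\<close>

section \<open>Matrix algebra, conjugate transposes and rank-one products\<close>

lemma matrix_add_rdistrib: "(A + B) ** C = A ** C + B ** C"
  for A :: "'a::semiring_1^'n^'m"
  by (simp add: matrix_matrix_mult_def vec_eq_iff sum.distrib distrib_right)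

lemma matrix_diff_ldistrib: "A ** (B - C) = A ** B - A ** C"
  for A :: "'a::ring_1^'n^'m"
  by (simp add: matrix_matrix_mult_def vec_eq_iff sum_subtractf right_diff_distrib)

lemma matrix_diff_rdistrib: "(A - B) ** C = A ** C - B ** C"
  for A :: "'a::ring_1^'n^'m"
  by (simp add: matrix_matrix_mult_def vec_eq_iff sum_subtractf left_diff_distrib)

lemma matrix_inv_left: "invertible A \<Longrightarrow> matrix_inv A ** A = mat 1"
  for A :: "'a::semiring_1^'n^'m"
  unfolding matrix_inv_def invertible_def by (rule conjunct2[OF someI_ex])

lemma conj_transpose_conj_transpose [simp]: "conj_transpose (conj_transpose A) = A"
  by (simp add: conj_transpose_def vec_eq_iff)

lemma conj_transpose_0 [simp]: "conj_transpose 0 = 0"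
  by (simp add: conj_transpose_def vec_eq_iff)

lemma conj_transpose_mat_1 [simp]: "conj_transpose (mat 1) = mat 1"
  by (simp add: conj_transpose_def mat_def vec_eq_iff)

lemma conj_transpose_add: "conj_transpose (A + B) = conj_transpose A + conj_transpose B"
  by (simp add: conj_transpose_def vec_eq_iff)

lemma conj_transpose_diff: "conj_transpose (A - B) = conj_transpose A - conj_transpose B"
  by (simp add: conj_transpose_def vec_eq_iff)

lemma conj_transpose_mult: "conj_transpose (A ** B) = conj_transpose B ** conj_transpose A"
  by (simp add: conj_transpose_def matrix_matrix_mult_def vec_eq_iff mult.commute)

lemma conj_transpose_cmat: "conj_transpose (cmat A) = cmat (transpose A)"
  by (simp add: conj_transpose_def cmat_def map_matrix_def transpose_def vec_eq_iff)

lemma bounded_linear_conj_transpose: "bounded_linear conj_transpose"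
  by (intro linear_conv_bounded_linear[THEN iffD1] linearI)
     (simp_all add: conj_transpose_def vec_eq_iff)

lemma conj_transpose_outer: "conj_transpose (outer u w) = outer w u"
  by (simp add: conj_transpose_def outer_def vec_eq_iff)

lemma outer_matrix_vector_left: "outer (B *v u) w = B ** outer u w"
  by (simp add: outer_def matrix_vector_mult_def matrix_matrix_mult_def vec_eq_iff
      sum_distrib_right mult.assoc)

lemma bounded_bilinear_outer: "bounded_bilinear outer"
  by (intro bilinear_conv_bounded_bilinear[THEN iffD1])
     (auto intro!: linearI simp: bilinear_def outer_def vec_eq_iff algebra_simps)

lemmas outer_add_left = bounded_bilinear.add_left[OF bounded_bilinear_outer]

lemma trace_outer_self: "trace (outer u u) = complex_of_real ((norm u)\<^sup>2)"
  by (simp add: trace_def outer_def norm_vec_def L2_set_def sum_nonneg complex_norm_square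
      flip: of_real_power)

section \<open>Square-integrable random vectors\<close>

definition sq_integrable :: "'w measure \<Rightarrow> ('w \<Rightarrow> 'a::euclidean_space) \<Rightarrow> bool" where
  "sq_integrable M X \<longleftrightarrow> X \<in> borel_measurable M \<and> integrable M (\<lambda>\<omega>. (norm (X \<omega>))\<^sup>2)"

lemma sq_integrable_measurable [measurable_dest]: "sq_integrable M X \<Longrightarrow> X \<in> borel_measurable M"
  by (simp add: sq_integrable_def)

lemma integrable_norm_bound:
  fixes f :: "'w \<Rightarrow> real" and g :: "'w \<Rightarrow> 'b::{banach, second_countable_topology}"
  assumes "integrable M f" "g \<in> borel_measurable M" "\<And>\<omega>. norm (g \<omega>) \<le> f \<omega>"
  shows "integrable M g"
  using assms by (intro Bochner_Integration.integrable_bound[of M f g] AE_I2)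
    (auto intro: order_trans[OF _ abs_ge_self])

lemma sq_integrable_bound:
  assumes "sq_integrable M X" "Y \<in> borel_measurable M" "\<And>\<omega>. norm (Y \<omega>) \<le> C * norm (X \<omega>)"
  shows "sq_integrable M Y"
proof -
  have "integrable M (\<lambda>\<omega>. (norm (Y \<omega>))\<^sup>2)"
  proof (rule integrable_norm_bound)
    show "integrable M (\<lambda>\<omega>. C\<^sup>2 * (norm (X \<omega>))\<^sup>2)"
      using assms(1) by (simp add: sq_integrable_def)
    show "norm ((norm (Y \<omega>))\<^sup>2) \<le> C\<^sup>2 * (norm (X \<omega>))\<^sup>2" for \<omega>
      using power_mono[OF assms(3) norm_ge_zero, of \<omega> 2] by (simp add: power_mult_distrib)
  qed (use assms(2) in measurable)
  with assms(2) show ?thesis by (simp add: sq_integrable_def)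
qed

lemma sq_integrable_bounded_linear:
  fixes f :: "'a::euclidean_space \<Rightarrow> 'b::euclidean_space"
  assumes "bounded_linear f" "sq_integrable M X"
  shows "sq_integrable M (\<lambda>\<omega>. f (X \<omega>))"
proof -
  from bounded_linear.bounded[OF assms(1)] obtain C where C: "\<And>x. norm (f x) \<le> norm x * C"
    by blast
  have "(\<lambda>\<omega>. f (X \<omega>)) \<in> borel_measurable M"
    using assms(2)
    by (intro measurable_compose[OF sq_integrable_measurable borel_measurable_continuous_onI]
        linear_continuous_on assms(1))
  with sq_integrable_bound[OF assms(2)] C show ?thesis
    by (metis mult.commute)
qed

lemma sq_integrable_add:
  fixes X Y :: "'w \<Rightarrow> 'a::euclidean_space"
  assumes "sq_integrable M X" "sq_integrable M Y"
  shows "sq_integrable M (\<lambda>\<omega>. X \<omega> + Y \<omega>)"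
proof -
  have "(norm (x + y))\<^sup>2 \<le> 2 * (norm x)\<^sup>2 + 2 * (norm y)\<^sup>2" for x y :: 'a
    using power_mono[OF norm_triangle_ineq norm_ge_zero, of x y 2]
      sum_squares_bound[of "norm x" "norm y"] by (simp add: power2_sum)
  note bound = this
  have [measurable]: "X \<in> borel_measurable M" "Y \<in> borel_measurable M"
    using assms by (simp_all add: sq_integrable_def)
  have "integrable M (\<lambda>\<omega>. (norm (X \<omega> + Y \<omega>))\<^sup>2)"
  proof (rule integrable_norm_bound)
    show "integrable M (\<lambda>\<omega>. 2 * (norm (X \<omega>))\<^sup>2 + 2 * (norm (Y \<omega>))\<^sup>2)"
      using assms by (simp add: sq_integrable_def)
  qed (use bound in simp_all)
  then show ?thesis by (simp add: sq_integrable_def)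
qed

lemma bounded_linear_matrix_vector_mult: "bounded_linear (\<lambda>x. A *v x)"
  for A :: "complex^'n^'m"
  by (intro linear_conv_bounded_linear[THEN iffD1] linearI)
     (simp_all add: matrix_vector_mult_def vec_eq_iff sum.distrib scaleR_right.sum distrib_left)

lemma bounded_linear_matrix_mult_left: "bounded_linear (\<lambda>X. A ** X)"
  for A :: "complex^'n^'m"
  by (intro linear_conv_bounded_linear[THEN iffD1] linearI)
     (simp_all add: matrix_matrix_mult_def vec_eq_iff sum.distrib scaleR_right.sum distrib_left)

lemma bounded_linear_cvec: "bounded_linear cvec"
  by (intro linear_conv_bounded_linear[THEN iffD1] linearI)
     (simp_all add: cvec_def vec_eq_iff scaleR_conv_of_real[where 'a = complex])

lemma bounded_linear_Re_trace: "bounded_linear (\<lambda>A :: complex^'n^'n. Re (trace A))"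
  by (intro linear_conv_bounded_linear[THEN iffD1] linearI)
     (simp_all add: trace_def sum.distrib scaleR_right.sum sum_distrib_left)

lemma cost_add: "cost (A + B) = cost A + cost B"
  by (simp add: cost_def trace_add add_divide_distrib)

lemma Re_trace_outer_self: "Re (trace (outer u u)) = (norm u)\<^sup>2"
  by (simp only: trace_outer_self Re_complex_of_real)

lemma (in prob_space) integrable_sq_integrable:
  fixes X :: "'a \<Rightarrow> 'b::euclidean_space"
  assumes "sq_integrable M X"
  shows "integrable M X"
proof -
  have "norm x \<le> 1 + (norm x)\<^sup>2" for x :: 'b
    using sum_squares_bound[of "norm x" 1] norm_ge_zero[of x] by (simp, linarith)
  with assms show ?thesis
    by (intro integrable_norm_bound[of M "\<lambda>\<omega>. 1 + (norm (X \<omega>))\<^sup>2" X]) (simp_all add: sq_integrable_def)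
qed

text \<open>Bilinearity bounds \<open>outer x y\<close> by a multiple of
  \<open>norm x * norm y\<close>, hence of the sum of the squared norms. Integrability is what makes
  \<open>cov\<close> additive: the Bochner integral falls back to 0 on non-integrable functions and
  is not linear across that default.\<close>

lemma integrable_outer:
  fixes X :: "'w \<Rightarrow> complex^'m" and Y :: "'w \<Rightarrow> complex^'n"
  assumes "sq_integrable M X" "sq_integrable M Y"
  shows "integrable M (\<lambda>\<omega>. outer (X \<omega>) (Y \<omega>))"
proof -
  obtain C where C: "C > 0"
    "\<And>x y. norm (outer (x::complex^'m) (y::complex^'n)) \<le> norm x * norm y * C"
    using bounded_bilinear.pos_bounded[OF bounded_bilinear_outer] by blast
  have "integrable M (\<lambda>\<omega>. C * ((norm (X \<omega>))\<^sup>2 + (norm (Y \<omega>))\<^sup>2))"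
    using assms by (simp add: sq_integrable_def)
  moreover have "(\<lambda>\<omega>. outer (X \<omega>) (Y \<omega>)) \<in> borel_measurable M"
    using assms[THEN sq_integrable_measurable]
  proof (rule borel_measurable_continuous_Pair)
    show "continuous_on UNIV (\<lambda>z :: (complex^'m) \<times> (complex^'n). outer (fst z) (snd z))"
      by (intro bounded_bilinear.continuous_on[OF bounded_bilinear_outer] continuous_intros)
  qed
  moreover have "norm (outer (X \<omega>) (Y \<omega>)) \<le> C * ((norm (X \<omega>))\<^sup>2 + (norm (Y \<omega>))\<^sup>2)" for \<omega>
  proof -
    have "norm (X \<omega>) * norm (Y \<omega>) \<le> (norm (X \<omega>))\<^sup>2 + (norm (Y \<omega>))\<^sup>2"
      using sum_squares_bound[of "norm (X \<omega>)" "norm (Y \<omega>)"]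
        mult_nonneg_nonneg[OF norm_ge_zero norm_ge_zero, of "X \<omega>" "Y \<omega>"] by linarith
    from mult_right_mono[OF this, of C] C(1) show ?thesis
      by (intro order_trans[OF C(2)]) (simp add: mult.commute)
  qed
  ultimately show ?thesis
    by (rule integrable_norm_bound)
qed

section \<open>Covariance calculus\<close>

lemma conj_transpose_cov_swap: "conj_transpose (cov M X Y) = cov M Y X"
  if "sq_integrable M X" "sq_integrable M Y"
  using integral_bounded_linear[OF bounded_linear_conj_transpose integrable_outer[OF that]]
  by (simp add: cov_def conj_transpose_diff conj_transpose_outer)

context prob_space
begin

lemma cov_add_left:
  assumes "sq_integrable M X" "sq_integrable M Y" "sq_integrable M Z"
  shows "cov M (\<lambda>\<omega>. X \<omega> + Y \<omega>) Z = cov M X Z + cov M Y Z"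
  using assms by (simp add: cov_def outer_add_left integrable_outer integrable_sq_integrable)

lemma cov_matrix_left:
  assumes "sq_integrable M X" "sq_integrable M Z"
  shows "cov M (\<lambda>\<omega>. B *v X \<omega>) Z = B ** cov M X Z"
  using integral_bounded_linear[OF bounded_linear_matrix_mult_left integrable_outer[OF assms], of B]
    integral_bounded_linear[OF bounded_linear_matrix_vector_mult integrable_sq_integrable[OF assms(1)], of B]
  by (simp add: cov_def outer_matrix_vector_left matrix_diff_ldistrib)

text \<open>Linearity in the first argument carries over to the second by conjugate transposition,
  and both cross terms vanish. The lemma serves twice: for the covariance update of the error, and
  with \<open>C = 0\<close> for the positivity of a conjugated error covariance.\<close>

lemma cov_linear_combination:
  assumes X: "sq_integrable M X" and Y: "sq_integrable M Y" and XY: "cov M X Y = 0"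
  shows "cov M (\<lambda>\<omega>. B *v X \<omega> + C *v Y \<omega>) (\<lambda>\<omega>. B *v X \<omega> + C *v Y \<omega>)
       = B ** cov M X X ** conj_transpose B + C ** cov M Y Y ** conj_transpose C"
proof -
  define Z where "Z = (\<lambda>\<omega>. B *v X \<omega> + C *v Y \<omega>)"
  note lin = sq_integrable_bounded_linear[OF bounded_linear_matrix_vector_mult]
  have Z: "sq_integrable M Z"
    unfolding Z_def by (intro sq_integrable_add lin X Y)
  have left: "cov M Z W = B ** cov M X W + C ** cov M Y W" if "sq_integrable M W"
    for W :: "'a \<Rightarrow> complex^'w"
    unfolding Z_def using that X Y by (simp add: cov_add_left cov_matrix_left lin)
  have YX: "cov M Y X = 0"
    using conj_transpose_cov_swap[OF X Y] XY by simp
  have "cov M X Z = cov M X X ** conj_transpose B" "cov M Y Z = cov M Y Y ** conj_transpose C"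
    using left[OF X] left[OF Y]
    by (simp_all add: conj_transpose_add conj_transpose_mult conj_transpose_cov XY YX
        flip: conj_transpose_cov_swap[OF Z X] conj_transpose_cov_swap[OF Z Y])
  with left[OF Z] show ?thesis
    by (simp add: Z_def matrix_mul_assoc)
qed

text \<open>The trace is the total variance, that is, the mean squared distance of \<open>X\<close>
  from its expectation. Expanding the square uses that constants integrate to themselves over a
  probability measure.\<close>

lemma Re_trace_cov_nonneg:
  assumes X: "sq_integrable M X"
  shows "0 \<le> Re (trace (cov M X X))"
proof -
  let ?\<mu> = "LINT \<omega>|M. X \<omega>"
  have int: "integrable M X" "integrable M (\<lambda>\<omega>. (norm (X \<omega>))\<^sup>2)"
    using X by (simp_all add: integrable_sq_integrable) (simp add: sq_integrable_def)
  have "0 \<le> (LINT \<omega>|M. (norm (X \<omega> - ?\<mu>))\<^sup>2)"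
    by simp
  also have "\<dots> = (LINT \<omega>|M. (norm (X \<omega>))\<^sup>2 - 2 * (X \<omega> \<bullet> ?\<mu>) + (norm ?\<mu>)\<^sup>2)"
    by (simp add: power2_norm_eq_inner inner_diff_left inner_diff_right inner_commute algebra_simps)
  also have "\<dots> = (LINT \<omega>|M. (norm (X \<omega>))\<^sup>2) - (norm ?\<mu>)\<^sup>2"
    using int by (simp add: prob_space power2_norm_eq_inner)
  also have "\<dots> = Re (trace (cov M X X))"
    using integral_bounded_linear[OF bounded_linear_Re_trace integrable_outer[OF X X]]
    by (simp add: cov_def trace_sub Re_trace_outer_self)
  finally show ?thesis .
qed

end

section \<open>Positive definite trace forms\<close>

lemma Re_trace_conj_cmat:
  fixes Z :: "complex^'m^'d" and R :: "real^'m^'m"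
  shows "Re (trace (Z ** cmat R ** conj_transpose Z))
    = (\<Sum>i\<in>UNIV. (\<chi> j. Re (Z$i$j)) \<bullet> (R *v (\<chi> j. Re (Z$i$j)))
        + (\<chi> j. Im (Z$i$j)) \<bullet> (R *v (\<chi> j. Im (Z$i$j))))"
proof -
  \<comment> \<open>Since \<open>R\<close> is real and
    \<open>Re (z * cnj w) = Re z * Re w + Im z * Im w\<close>, each row of \<open>Z\<close>
    contributes the real quadratic form of its real part plus that of its imaginary part.\<close>
  have "Re (\<Sum>l\<in>UNIV. (\<Sum>j\<in>UNIV. Z$i$j * complex_of_real (R$j$l)) * cnj (Z$i$l))
      = (\<Sum>l\<in>UNIV. \<Sum>j\<in>UNIV. R$j$l * (Re (Z$i$j) * Re (Z$i$l) + Im (Z$i$j) * Im (Z$i$l)))" for i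
    by (simp add: sum_distrib_right sum_distrib_left sum.distrib algebra_simps)
  also have "\<dots> i = (\<Sum>j\<in>UNIV. \<Sum>l\<in>UNIV. R$j$l * (Re (Z$i$j) * Re (Z$i$l) + Im (Z$i$j) * Im (Z$i$l)))" for i
    by (rule sum.swap)
  finally show ?thesis
    by (simp add: trace_def matrix_matrix_mult_def conj_transpose_def cmat_def map_matrix_def
        inner_vec_def matrix_vector_mult_def sum_distrib_left sum.distrib algebra_simps)
qed

text \<open>A nonzero entry in row \<open>i\<close> makes the real or the imaginary part of that row
  a nonzero vector. So the summand for \<open>i\<close> is positive, while all others are
  nonnegative.\<close>

lemma Re_trace_conj_cmat_pos:
  fixes Z :: "complex^'m^'d"
  assumes "pos_def R" "Z \<noteq> 0"
  shows "0 < Re (trace (Z ** cmat R ** conj_transpose Z))"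
proof -
  have nonneg: "0 \<le> x \<bullet> (R *v x)" for x
    using assms(1) by (cases "x = 0") (auto simp: pos_def_def intro: less_imp_le)
  obtain i j where ij: "Z$i$j \<noteq> 0"
    using assms(2) by (auto simp: vec_eq_iff)
  have pos: "0 < x \<bullet> (R *v x)" if "x $ j \<noteq> 0" for x
    using assms(1) that unfolding pos_def_def by (metis zero_index)
  have "0 < (\<chi> j. Re (Z$i$j)) \<bullet> (R *v (\<chi> j. Re (Z$i$j)))
        + (\<chi> j. Im (Z$i$j)) \<bullet> (R *v (\<chi> j. Im (Z$i$j)))"
  proof (cases "Re (Z$i$j) = 0")
    case True
    with ij have "Im (Z$i$j) \<noteq> 0" by (simp add: complex_eq_iff)
    then show ?thesis by (intro add_nonneg_pos nonneg pos) simp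
  next
    case False
    then show ?thesis by (intro add_pos_nonneg nonneg pos) simp
  qed
  then show ?thesis
    unfolding Re_trace_conj_cmat by (intro sum_pos2[of _ i]) (auto intro: nonneg add_nonneg_nonneg)
qed

lemma invertible_if_Re_trace_pos:
  fixes S :: "complex^'m^'m"
  assumes pos: "\<And>Z :: complex^'m^'d. Z \<noteq> 0 \<Longrightarrow> 0 < Re (trace (Z ** S ** conj_transpose Z))"
  shows "invertible S"
proof -
  have "x = 0" if "S *v x = 0" for x
  proof (rule ccontr)
    assume "x \<noteq> 0"
    \<comment> \<open>Every row of \<open>Z\<close> is the conjugate of \<open>x\<close>, so every
      column of \<open>conj_transpose Z\<close> is the kernel vector \<open>x\<close> itself, and
      \<open>S\<close> annihilates it.\<close>
    define Z :: "complex^'m^'d" where "Z = (\<chi> i j. cnj (x $ j))"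
    have "Z \<noteq> 0"
      using \<open>x \<noteq> 0\<close> by (auto simp: Z_def vec_eq_iff)
    moreover have "S ** conj_transpose Z = 0"
      using that
      by (simp add: Z_def conj_transpose_def matrix_matrix_mult_def matrix_vector_mult_def vec_eq_iff)
    then have "Z ** S ** conj_transpose Z = 0"
      by (simp flip: matrix_mul_assoc)
    ultimately show False
      using pos[of Z] by (simp add: trace_def)
  qed
  then show ?thesis
    by (simp add: invertible_left_inverse matrix_left_invertible_ker)
qed

section \<open>Completing the square and minimizing the trace\<close>

lemma joseph_form_complete_square:
  fixes P :: "complex^'d^'d" and H :: "complex^'d^'m" and R :: "complex^'m^'m"
  defines "S \<equiv> H ** P ** conj_transpose H + R"
  defines "G \<equiv> P ** conj_transpose H ** matrix_inv S"
  assumes P: "conj_transpose P = P" and R: "conj_transpose R = R" and inv: "invertible S"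
  shows "(mat 1 - X ** H) ** P ** conj_transpose (mat 1 - X ** H) + X ** R ** conj_transpose X
       = (P - G ** H ** P) + (X - G) ** S ** conj_transpose (X - G)"
proof -
  let ?c = conj_transpose
  have S: "?c S = S"
    by (simp add: S_def conj_transpose_add conj_transpose_mult P R matrix_mul_assoc)
  \<comment> \<open>The inverse enters only through this equation and its conjugate transpose
    \<open>SG\<close>; they turn the mixed terms of the square into those of the expanded left-hand
    side.\<close>
  have GS: "G ** S = P ** ?c H"
    using matrix_inv_left[OF inv] by (simp add: G_def flip: matrix_mul_assoc)
  have SG: "S ** ?c G = H ** P"
    using arg_cong[OF GS, of ?c] by (simp add: conj_transpose_mult S P)
  have "(X - G) ** S ** ?c (X - G) = X ** S ** ?c X - X ** (S ** ?c G) - G ** S ** ?c X + G ** (S ** ?c G)"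
    by (simp add: conj_transpose_diff matrix_diff_ldistrib matrix_diff_rdistrib matrix_mul_assoc)
  also have "\<dots> = X ** S ** ?c X - X ** H ** P - P ** ?c H ** ?c X + G ** H ** P"
    by (simp add: GS SG matrix_mul_assoc)
  finally have square: "(X - G) ** S ** ?c (X - G)
      = X ** S ** ?c X - X ** H ** P - P ** ?c H ** ?c X + G ** H ** P" .
  show ?thesis
    unfolding square
    by (simp add: S_def conj_transpose_diff conj_transpose_mult matrix_diff_ldistrib
        matrix_diff_rdistrib matrix_add_ldistrib matrix_add_rdistrib matrix_mul_assoc)
qed

text \<open>Away from \<open>G\<close> the quadratic term adds a strictly positive cost to that of
  \<open>C\<close>. This strictness yields uniqueness of the minimizer along with its
  existence.\<close>

lemma is_arg_min_cost_iff:
  fixes S :: "complex^'m^'m" and G L :: "complex^'m^'d"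
  assumes pos: "\<And>Z :: complex^'m^'d. Z \<noteq> 0 \<Longrightarrow> 0 < Re (trace (Z ** S ** conj_transpose Z))"
    and F: "\<And>X. F X = C + (X - G) ** S ** conj_transpose (X - G)"
  shows "is_arg_min (\<lambda>X. cost (F X)) (\<lambda>_. True) L \<longleftrightarrow> L = G"
proof -
  have FG: "F G = C" by (simp add: F)
  have gt: "cost (F G) < cost (F X)" if "X \<noteq> G" for X
    using pos[of "X - G"] that by (simp add: FG, simp add: F cost_add, simp add: cost_def)
  then show ?thesis
    unfolding is_arg_min_def by (metis less_asym less_irrefl)
qed

section \<open>Zero mean and finite second moments of the noise\<close>

lemma distr_density_lborel_uminus:
  fixes f :: "'a::euclidean_space \<Rightarrow> ennreal"
  assumes [measurable]: "f \<in> borel_measurable borel" and even: "\<And>x. f (- x) = f x"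
  shows "distr (density lborel f) lborel uminus = density lborel f"
proof -
  \<comment> \<open>Reflection is the affine map with shift 0 and scale -1, whose Jacobian factor is
    1 in absolute value.\<close>
  have "distr lborel lborel uminus = distr lborel borel (\<lambda>x :: 'a. 0 + (- 1) *\<^sub>R x)"
    by (rule distr_cong) simp_all
  also have "\<dots> = lborel"
    by (subst (2) lborel_affine[of "- 1" "0 :: 'a"]) (simp_all add: density_1)
  finally have "distr lborel lborel uminus = (lborel :: 'a measure)" .
  then show ?thesis
    using density_distr[of f lborel uminus lborel] even by simp
qed

text \<open>By reflection the expectation equals its own negative. Each equality in the chain also
  holds for a non-integrable function, whose integral is 0 by convention. For the noise this gives
  mean zero from the evenness of \<open>mvn_density\<close> alone, without evaluating a Gaussian
  integral.\<close>

lemma expectation_even_density: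
  fixes M :: "'w measure" and X :: "'w \<Rightarrow> real^'m" and g :: "real^'m \<Rightarrow> complex^'m"
  assumes d: "distributed M lborel X f" and even: "\<And>x. f (- x) = f x"
    and g: "bounded_linear g"
  shows "(LINT \<omega>|M. g (X \<omega>)) = 0"
proof -
  have f [measurable]: "f \<in> borel_measurable borel"
    using distributed_borel_measurable[OF d] by simp
  have X [measurable]: "X \<in> borel_measurable M"
    using distributed_measurable[OF d] by simp
  have gm [measurable]: "g \<in> borel_measurable borel"
    by (intro borel_measurable_continuous_onI linear_continuous_on g)
  have "(LINT \<omega>|M. g (X \<omega>)) = integral\<^sup>L (distr M lborel X) g"
    by (simp add: integral_distr)
  also have "\<dots> = integral\<^sup>L (distr (density lborel f) lborel uminus) g"
    by (simp add: distributed_distr_eq_density[OF d] distr_density_lborel_uminus even)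
  also have "\<dots> = integral\<^sup>L (density lborel f) (\<lambda>x. - g x)"
    by (simp add: integral_distr linear_neg[OF bounded_linear.linear[OF g]])
  also have "\<dots> = - integral\<^sup>L (distr M lborel X) g"
    by (simp add: distributed_distr_eq_density[OF d])
  also have "\<dots> = - (LINT \<omega>|M. g (X \<omega>))"
    by (simp add: integral_distr)
  finally have "2 *\<^sub>R (LINT \<omega>|M. g (X \<omega>)) = 0"
    by (simp add: scaleR_2)
  then show ?thesis by simp
qed

lemma matrix_vector_mult_uminus_right: "A *v (- x) = - (A *v x)"
  for A :: "'a::ring_1^'n^'m"
  by (simp add: matrix_vector_mult_def vec_eq_iff sum_negf)

lemma mvn_density_uminus: "mvn_density R (- x) = mvn_density R x"
  by (simp add: mvn_density_def matrix_vector_mult_uminus_right)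

lemma cmat_pos_def_neq_0: "cmat R \<noteq> 0" if "pos_def R"
proof
  assume "cmat R = 0"
  then have "R = 0" by (simp add: cmat_def map_matrix_def vec_eq_iff)
  \<comment> \<open>The test vector \<open>1\<close> has all entries equal to one.\<close>
  moreover have "(1 :: real^'a) \<noteq> 0" by (simp add: vec_eq_iff)
  with that have "0 < (1 :: real^'a) \<bullet> (R *v 1)" unfolding pos_def_def by blast
  ultimately show False by simp
qed

text \<open>
  The Bochner integral of a non-integrable function is \<open>0\<close>, so a nonzero second moment already
  forces square integrability.
\<close>

lemma sq_integrable_cvec_if_second_moment_pos_def:
  fixes V :: "'w \<Rightarrow> real^'m"
  assumes [measurable]: "V \<in> borel_measurable M"
    and cov: "(LINT \<omega>|M. outer (cvec (V \<omega>)) (cvec (V \<omega>))) = cmat R" and R: "pos_def R"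
  shows "sq_integrable M (\<lambda>\<omega>. cvec (V \<omega>))"
proof -
  have "integrable M (\<lambda>\<omega>. outer (cvec (V \<omega>)) (cvec (V \<omega>)))"
    using cov cmat_pos_def_neq_0[OF R] not_integrable_integral_eq by metis
  \<comment> \<open>The trace of \<open>outer u u\<close> is the squared norm of \<open>u\<close>,
    so integrability passes from the matrix to the squared norm.\<close>
  from integrable_bounded_linear[OF bounded_linear_Re_trace this]
  have "integrable M (\<lambda>\<omega>. (norm (cvec (V \<omega>)))\<^sup>2)"
    by (simp add: Re_trace_outer_self)
  moreover have "(\<lambda>\<omega>. cvec (V \<omega>)) \<in> borel_measurable M"
    by (intro measurable_compose[OF assms(1)] borel_measurable_continuous_onI
        linear_continuous_on bounded_linear_cvec)
  ultimately show ?thesis by (simp add: sq_integrable_def)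
qed

section \<open>The error recursion and the optimal gain\<close>

lemma state_eq_transition: "state A x0 k = transition A k *v x0"
  by (induction k) (simp_all add: matrix_vector_mul_assoc)

text \<open>The noise-free part of the measurement at time \<open>k\<close> is
  \<open>obs_tilde A H k *v x0\<close>, so the innovation is the noise minus
  \<open>obs_tilde A H k\<close> applied to the current error. Note the shift: the gain with index
  \<open>Suc k\<close> meets the noise with index \<open>k\<close>.\<close>

lemma estimator_error_Suc:
  "estimator A H x0 v xh0 K (Suc k) \<omega> - x0
   = (mat 1 - K (Suc k) ** obs_tilde A H k) *v (estimator A H x0 v xh0 K k \<omega> - x0)
     + K (Suc k) *v cvec (v k \<omega>)"
  by (simp add: measurement_def obs_tilde_def state_eq_transition matrix_vector_mul_assoc
      matrix_vector_mult_diff_distrib matrix_vector_mult_diff_rdistrib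
      matrix_vector_right_distrib matrix_mul_assoc)

lemma estimator_cong:
  "(\<And>i. 1 \<le> i \<Longrightarrow> i \<le> k \<Longrightarrow> K i = K' i) \<Longrightarrow>
   estimator A H x0 v xh0 K k \<omega> = estimator A H x0 v xh0 K' k \<omega>"
  by (induction k) auto

text \<open>The estimator at time \<open>k\<close> reads only the gains \<open>1\<close> to
  \<open>k\<close>. Hence the previous covariance stays fixed while the next gain varies in the
  minimization.\<close>

lemma error_cov_upd: "error_cov M A H x0 v xh0 (K(Suc k := X)) k = error_cov M A H x0 v xh0 K k"
  unfolding error_cov_def by (subst estimator_cong[where K' = K]) auto

text \<open>The first conjunct allows an arbitrary gain history, so it gives existence and
  uniqueness of the minimizer at every single step. The covariance update is a property of the
  optimal gain, so the second conjunct speaks of sequences that are minimizing at each step.\<close>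

theorem theorem3p1:
  fixes M :: "'w measure"
    and A :: "nat \<Rightarrow> complex^'d^'d"
    and H :: "nat \<Rightarrow> complex^'d^'m"
    and R :: "nat \<Rightarrow> real^'m^'m"
    and x0 :: "complex^'d"
    and v :: "nat \<Rightarrow> 'w \<Rightarrow> real^'m"
    and xh0 :: "'w \<Rightarrow> complex^'d"
    and \<sigma> :: real
    and Ht :: "nat \<Rightarrow> complex^'d^'m"
    and P :: "(nat \<Rightarrow> complex^'m^'d) \<Rightarrow> nat \<Rightarrow> complex^'d^'d"
  assumes dims: "CARD('m) < CARD('d)"
    and prob: "prob_space M"
    and A_inv: "\<And>k. k \<ge> 1 \<Longrightarrow> invertible (A k)"
    and R_pd: "\<And>k. pos_def (R k)"
    and sigma_pos: "\<sigma>\<^sup>2 > 0"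
    and R_lower: "\<And>k. loewner_le (\<sigma>\<^sup>2 *\<^sub>R mat 1) (R k)"
    and v_normal: "\<And>k. distributed M lborel (v k) (\<lambda>x. ennreal (mvn_density (R k) x))"
    and v_cov: "\<And>j k. (LINT \<omega>|M. outer (cvec (v j \<omega>)) (cvec (v k \<omega>)))
                         = (if j = k then cmat (R k) else 0)"
    and xh0_meas: "xh0 \<in> borel_measurable M"
    and xh0_sq_int: "integrable M (\<lambda>\<omega>. (norm (xh0 \<omega>))\<^sup>2)"
    and uncorr: "\<And>k. (LINT \<omega>|M. outer (cvec (v k \<omega>)) (xh0 \<omega> - x0)) = 0"
    and Ht_eq: "Ht = obs_tilde A H"
    and P_eq: "P = error_cov M A H x0 v xh0"
  shows
    "(\<forall>K k L. k \<ge> 1 \<longrightarrow>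
        invertible (Ht (k-1) ** P K (k-1) ** conj_transpose (Ht (k-1)) + cmat (R (k-1))) \<and>
        (is_arg_min (\<lambda>X. cost (P (K(k := X)) k)) (\<lambda>_. True) L \<longleftrightarrow>
           L = P K (k-1) ** conj_transpose (Ht (k-1)) **
                 matrix_inv (Ht (k-1) ** P K (k-1) ** conj_transpose (Ht (k-1)) + cmat (R (k-1))))) \<and>
     (\<forall>K. (\<forall>k\<ge>1. is_arg_min (\<lambda>X. cost (P (K(k := X)) k)) (\<lambda>_. True) (K k)) \<longrightarrow>
        (\<forall>k\<ge>1.
           K k = P K (k-1) ** conj_transpose (Ht (k-1)) **
                   matrix_inv (Ht (k-1) ** P K (k-1) ** conj_transpose (Ht (k-1)) + cmat (R (k-1))) \<and>
           P K k = P K (k-1) - K k ** Ht (k-1) ** P K (k-1)))"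
proof -
  interpret prob_space M by (rule prob)
  define V where "V k = (\<lambda>\<omega>. cvec (v k \<omega>))" for k
  define e where "e K k = (\<lambda>\<omega>. estimator A H x0 v xh0 K k \<omega> - x0)" for K k
  let ?c = conj_transpose
  note sq_mult = sq_integrable_bounded_linear[OF bounded_linear_matrix_vector_mult]

  have V: "sq_integrable M (V k)" for k
    unfolding V_def using distributed_measurable[OF v_normal[of k]] v_cov[of k k] R_pd[of k]
    by (intro sq_integrable_cvec_if_second_moment_pos_def) auto
  have EV: "(LINT \<omega>|M. V k \<omega>) = 0" for k
    unfolding V_def
    by (intro expectation_even_density[OF v_normal] bounded_linear_cvec) (simp add: mvn_density_uminus)
  \<comment> \<open>Because the noise has mean zero, its covariances are the raw second moments in
    which \<open>v_cov\<close> and \<open>uncorr\<close> are stated.\<close>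
  have cov_V: "cov M (V j) X = (LINT \<omega>|M. outer (V j \<omega>) (X \<omega>))" for j and X :: "'w \<Rightarrow> complex^'n"
    by (simp add: cov_def EV bounded_bilinear.zero_left[OF bounded_bilinear_outer])
  have cov_VV: "cov M (V j) (V k) = (if j = k then cmat (R k) else 0)" for j k
    unfolding cov_V unfolding V_def by (rule v_cov)

  have e_0: "e K 0 = (\<lambda>\<omega>. xh0 \<omega> - x0)" for K
    by (simp add: e_def)
  have e_Suc: "e K (Suc n) = (\<lambda>\<omega>. (mat 1 - K (Suc n) ** Ht n) *v e K n \<omega> + K (Suc n) *v V n \<omega>)" for K n
    unfolding e_def V_def Ht_eq by (intro ext estimator_error_Suc)
  have e: "sq_integrable M (e K n)" for K n
  proof (induction n)
    case 0
    have "sq_integrable M (\<lambda>\<omega>. xh0 \<omega> + - x0)"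
      by (intro sq_integrable_add) (use xh0_meas xh0_sq_int in \<open>simp_all add: sq_integrable_def\<close>)
    then show ?case by (simp add: e_0)
  next
    case (Suc n)
    then show ?case unfolding e_Suc by (intro sq_integrable_add sq_mult V)
  qed
  \<comment> \<open>The error at time \<open>n\<close> involves only noise with index below
    \<open>n\<close>. In the induction step \<open>Suc n \<le> j\<close> gives
    \<open>n \<noteq> j\<close>, so the newly added noise is uncorrelated with
    \<open>V j\<close>.\<close>
  have cov_eV: "cov M (e K n) (V j) = 0" if "n \<le> j" for K n j
    using that
  proof (induction n)
    case 0
    have "cov M (V j) (e K 0) = 0"
      unfolding cov_V e_0 unfolding V_def by (rule uncorr)
    then show ?case
      using conj_transpose_cov_swap[OF V e] by (metis conj_transpose_0)
  next
    case (Suc n)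
    then show ?case
      by (simp add: e_Suc cov_add_left cov_matrix_left sq_mult V e cov_VV)
  qed

  have P_cov: "P K n = cov M (e K n) (e K n)" for K n
    by (simp add: P_eq error_cov_def e_def Let_def)
  have P_herm: "?c (P K n) = P K n" for K n
    by (simp add: P_cov conj_transpose_cov)
  have P_Suc: "P K (Suc n) = (mat 1 - K (Suc n) ** Ht n) ** P K n ** ?c (mat 1 - K (Suc n) ** Ht n)
      + K (Suc n) ** cmat (R n) ** ?c (K (Suc n))" for K n
    unfolding P_cov e_Suc by (simp add: cov_linear_combination[OF e V cov_eV] cov_VV)
  have P_upd: "P (K(Suc n := X)) n = P K n" for K n X
    by (simp add: P_eq error_cov_upd)

  define S where "S K n = Ht n ** P K n ** ?c (Ht n) + cmat (R n)" for K n
  define G where "G K n = P K n ** ?c (Ht n) ** matrix_inv (S K n)" for K n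
  have S_pos: "0 < Re (trace (Z ** S K n ** ?c Z))" if "Z \<noteq> 0" for Z :: "complex^'m^'d" and K n
  proof -
    have "Z ** S K n ** ?c Z = (Z ** Ht n) ** P K n ** ?c (Z ** Ht n) + Z ** cmat (R n) ** ?c Z"
      by (simp add: S_def matrix_add_ldistrib matrix_add_rdistrib conj_transpose_mult matrix_mul_assoc)
    \<comment> \<open>The matrix is the covariance of \<open>(Z ** Ht n) *v e K n\<close>, as
      \<open>cov_linear_combination\<close> shows with second coefficient 0, so its trace is a total
      variance.\<close>
    moreover have "0 \<le> Re (trace ((Z ** Ht n) ** P K n ** ?c (Z ** Ht n)))"
      using Re_trace_cov_nonneg[OF sq_mult[OF e], of "Z ** Ht n" K n]
        cov_linear_combination[OF e V cov_eV[OF order_refl], of "Z ** Ht n" K n "0 :: complex^'m^'d"]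
      by (simp add: P_cov)
    ultimately show ?thesis
      using Re_trace_conj_cmat_pos[OF R_pd that] by (simp add: trace_add add_nonneg_pos)
  qed
  then have S_inv: "invertible (S K n)" for K n
    by (rule invertible_if_Re_trace_pos)
  have square: "P K (Suc n) = (P K n - G K n ** Ht n ** P K n)
      + (K (Suc n) - G K n) ** S K n ** ?c (K (Suc n) - G K n)" for K n
    unfolding P_Suc G_def S_def
    by (rule joseph_form_complete_square)
       (use P_herm R_pd[of n] S_inv[of K n] in \<open>simp_all add: conj_transpose_cmat pos_def_def S_def\<close>)
  \<comment> \<open>By \<open>P_upd\<close> the new gain leaves \<open>P K n\<close>, and with it
    \<open>S K n\<close> and \<open>G K n\<close>, unchanged. Thus \<open>square\<close> exhibits
    the cost as that of a constant plus a square in \<open>X\<close>.\<close>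
  have argmin: "is_arg_min (\<lambda>X. cost (P (K(Suc n := X)) (Suc n))) (\<lambda>_. True) L \<longleftrightarrow> L = G K n" for K n L
    by (rule is_arg_min_cost_iff[where S = "S K n" and C = "P K n - G K n ** Ht n ** P K n"])
       (use S_pos in \<open>simp_all add: square[of "K(Suc n := _)" n] P_upd G_def S_def\<close>)

  have step: "invertible (S K (k-1)) \<and>
      (is_arg_min (\<lambda>X. cost (P (K(k := X)) k)) (\<lambda>_. True) L \<longleftrightarrow> L = G K (k-1))"
    if "k \<ge> 1" for K k L
    using that S_inv argmin by (cases k) simp_all
  moreover have "K k = G K (k-1) \<and> P K k = P K (k-1) - K k ** Ht (k-1) ** P K (k-1)"
    if "\<forall>k\<ge>1. is_arg_min (\<lambda>X. cost (P (K(k := X)) k)) (\<lambda>_. True) (K k)" "k \<ge> 1" for K k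
  proof -
    obtain n where n: "k = Suc n" using \<open>k \<ge> 1\<close> by (cases k) auto
    have "K k = G K n" using step[of k K "K k"] that n by simp
    \<comment> \<open>At \<open>K k = G K n\<close> the square vanishes, and only the updated
      covariance remains.\<close>
    with square[of K n] show ?thesis by (simp add: n)
  qed
  ultimately show ?thesis
    unfolding G_def S_def by blast
qed

end
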